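(* Let $\beta\in\mathcal{B}_2\setminus\mathcal{B}_1$. Then for every $\lambda>0$ the limit $Z(\lambda,\beta)=\lim_{n\to+\infty}Z_n(\lambda,\beta)$ exists and $Z(\lambda,\beta)=0$. At the same time $Z(0,\beta)=1$.
   Context: For $k\in\mathbb{N}=\{1,2,\dots\}$, $\mathcal{B}_k$ is the set of real sequences $\beta=\{\beta_j\}_{j=1}^{+\infty}$ with $\beta_j>0$ for all $j$ and $\sum_{j=1}^{+\infty}\beta_j^{-k}<+\infty$. For $n\in\mathbb{N}$ and $\lambda\ge0$, $$Z_n(\lambda,\beta)=\Big(\prod_{j=1}^{n}\int_{\mathbb{R}}\frac{\mathrm{d}a_j}{\sqrt{\pi/\beta_j}}\Big)\exp\Big(-\sum_{j=1}^n\beta_ja_j^2-\lambda\Big(\sum_{j=1}^na_j^2\Big)^2\Big).$$ *)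

theory Defs
  imports "HOL-Analysis.Analysis"
begin

(* A sequence beta_1, beta_2, ... is a function on nat, with "\<beta> j" standing for beta_{j+1};
   accordingly the indices 1, ..., n become {..<n}. *)

definition seq_class :: "nat \<Rightarrow> (nat \<Rightarrow> real) set" where
  "seq_class k = {\<beta>. (\<forall>j. \<beta> j > 0) \<and> summable (\<lambda>j. 1 / \<beta> j ^ k)}"

(* For "\<beta> > 0" and "l \<ge> 0" the integrand is continuous, positive and bounded by an integrable Gaussian
   density, so the iterated integral is the integral over the product measure, and the default
   value 0 of the Bochner integral for non-integrable functions never occurs. *)

definition Z_fin :: "nat \<Rightarrow> real \<Rightarrow> (nat \<Rightarrow> real) \<Rightarrow> real" where
  "Z_fin n l \<beta> =
     (\<integral>a. (\<Prod>j<n. 1 / sqrt (pi / \<beta> j)) *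
         exp (- (\<Sum>j<n. \<beta> j * (a j)\<^sup>2) - l * (\<Sum>j<n. (a j)\<^sup>2)\<^sup>2)
       \<partial>(\<Pi>\<^sub>M j\<in>{..<n}. lborel))"

(* Meaningful only when the sequence converges, which has to be asserted separately. *)

definition Z_lim :: "real \<Rightarrow> (nat \<Rightarrow> real) \<Rightarrow> real" where
  "Z_lim l \<beta> = lim (\<lambda>n. Z_fin n l \<beta>)"

end

theory Submission
  imports Defs "HOL-Probability.Distributions"
begin

text \<open>
  Completing the square gives \<open>- l * X\<^sup>2 \<le> - X + 1 / (4 * l)\<close>. Applied to
  \<open>X = \<Sum>j<n. (a j)\<^sup>2\<close>, this bounds \<open>Z_fin n l \<beta>\<close> by a constant times a Gaussian integral that
  factorises into \<open>\<Prod>j<n. (1 + 1 / \<beta> j) powr (-1/2)\<close>; since \<open>\<Sum>j. 1 / \<beta> j\<close> diverges, this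
  product tends to \<open>0\<close>.
\<close>

lemma
  fixes b :: real
  assumes "b > 0"
  shows integrable_exp_neg_mult_square: "integrable lborel (\<lambda>x. exp (- b * x\<^sup>2))"
    and integral_exp_neg_mult_square: "(\<integral>x. exp (- b * x\<^sup>2) \<partial>lborel) = sqrt (pi / b)"
proof -
  \<comment> \<open>This standard deviation makes the exponent of the normal density equal to
    \<open>- b * x\<^sup>2\<close>. The density has mass 1, so only its normalising factor
    \<open>sqrt (pi / b)\<close> is left.\<close>
  let ?s = "1 / sqrt (2 * b)"
  have eq: "exp (- b * x\<^sup>2) = sqrt (pi / b) * normal_density 0 ?s x" for x
    using assms by (simp add: normal_density_def power_divide real_sqrt_divide power_mult_distrib)
  show "integrable lborel (\<lambda>x. exp (- b * x\<^sup>2))"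
    unfolding eq using assms by (intro integrable_mult_right integrable_normal_density) simp
  show "(\<integral>x. exp (- b * x\<^sup>2) \<partial>lborel) = sqrt (pi / b)"
    unfolding eq using assms by (simp add: integral_normal_density)
qed

text \<open>The exponential of the sum splits into factors that depend on one coordinate each, so
  Fubini reduces the integral to one-dimensional Gaussians. The constant is carried as a product
  over \<open>I\<close> to match the normalisation in \<open>Z_fin\<close>.\<close>

lemma
  fixes b c :: "'i \<Rightarrow> real"
  assumes "finite I" and "\<And>i. i \<in> I \<Longrightarrow> b i > 0"
  shows integrable_prod_gaussian:
      "integrable (\<Pi>\<^sub>M i\<in>I. lborel) (\<lambda>a. (\<Prod>i\<in>I. c i) * exp (- (\<Sum>i\<in>I. b i * (a i)\<^sup>2)))"
    and integral_prod_gaussian: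
      "(\<integral>a. (\<Prod>i\<in>I. c i) * exp (- (\<Sum>i\<in>I. b i * (a i)\<^sup>2)) \<partial>(\<Pi>\<^sub>M i\<in>I. lborel)) =
        (\<Prod>i\<in>I. c i * sqrt (pi / b i))"
proof -
  interpret product_sigma_finite "\<lambda>_ :: 'i. lborel :: real measure"
    by standard
  have eq: "(\<Prod>i\<in>I. c i) * exp (- (\<Sum>i\<in>I. b i * (a i)\<^sup>2)) =
      (\<Prod>i\<in>I. c i * exp (- b i * (a i)\<^sup>2))" for a :: "'i \<Rightarrow> real"
    using assms(1) by (simp add: prod.distrib exp_sum flip: sum_negf)
  have int: "integrable lborel (\<lambda>x. c i * exp (- b i * x\<^sup>2))" if "i \<in> I" for i
    using assms(2)[OF that] by (intro integrable_mult_right integrable_exp_neg_mult_square)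
  show "integrable (\<Pi>\<^sub>M i\<in>I. lborel) (\<lambda>a. (\<Prod>i\<in>I. c i) * exp (- (\<Sum>i\<in>I. b i * (a i)\<^sup>2)))"
    unfolding eq using assms(1) int by (rule product_integrable_prod)
  show "(\<integral>a. (\<Prod>i\<in>I. c i) * exp (- (\<Sum>i\<in>I. b i * (a i)\<^sup>2)) \<partial>(\<Pi>\<^sub>M i\<in>I. lborel)) =
      (\<Prod>i\<in>I. c i * sqrt (pi / b i))"
    unfolding eq
    by (subst product_integral_prod[OF assms(1) int])
      (auto intro!: prod.cong simp only: integral_mult_right_zero
        integral_exp_neg_mult_square[OF assms(2)])
qed

lemma sqrt_prod: "sqrt (prod f A) = (\<Prod>x\<in>A. sqrt (f x))"
  by (induction A rule: infinite_finite_induct) (simp_all add: real_sqrt_mult)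

lemma Z_fin_zero:
  assumes "\<And>j. \<beta> j > 0"
  shows "Z_fin n 0 \<beta> = 1"
proof -
  have "Z_fin n 0 \<beta> = (\<Prod>j<n. 1 / sqrt (pi / \<beta> j) * sqrt (pi / \<beta> j))"
    unfolding Z_fin_def using assms by (subst integral_prod_gaussian[symmetric]) auto
  also have "\<dots> = 1"
    using assms by (intro prod.neutral ballI) (simp add: less_imp_neq[symmetric])
  finally show ?thesis .
qed

lemma Z_fin_nonneg: "0 \<le> Z_fin n l \<beta>" if "\<And>j. \<beta> j > 0"
  unfolding Z_fin_def using that
  by (intro Bochner_Integration.integral_nonneg mult_nonneg_nonneg prod_nonneg)
    (auto intro: less_imp_le)

lemma neg_mult_square_le:
  fixes l x :: real
  assumes "l > 0"
  shows "- l * x\<^sup>2 \<le> 1 / (4 * l) - x"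
proof -
  have "1 / (4 * l) - x + l * x\<^sup>2 = l * (x - 1 / (2 * l))\<^sup>2"
    using assms by (simp add: field_simps power2_eq_square)
  also have "\<dots> \<ge> 0"
    using assms by simp
  finally show ?thesis by simp
qed

text \<open>Trading the quartic term for \<open>- X\<close> raises each Gaussian coefficient from
  \<open>\<beta> j\<close> to \<open>\<beta> j + 1\<close>, while the normalisation still belongs to
  \<open>\<beta> j\<close>. Each coordinate thus contributes
  \<open>sqrt (\<beta> j / (\<beta> j + 1))\<close>, and the price is a factor independent of
  \<open>n\<close>.\<close>

lemma Z_fin_le:
  assumes pos: "\<And>j. \<beta> j > 0" and l: "l > 0"
  shows "Z_fin n l \<beta> \<le> exp (1 / (4 * l)) / sqrt (\<Prod>j<n. 1 + 1 / \<beta> j)"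
proof -
  let ?c = "\<Prod>j<n. 1 / sqrt (pi / \<beta> j)"
  let ?g = "\<lambda>a. ?c * exp (- (\<Sum>j<n. (\<beta> j + 1) * (a j)\<^sup>2))"
  have pos1: "\<beta> j + 1 > 0" for j
    using pos[of j] by simp
  have c: "?c \<ge> 0"
    using pos by (intro prod_nonneg) (auto intro: less_imp_le)
  have le: "?c * exp (- (\<Sum>j<n. \<beta> j * (a j)\<^sup>2) - l * (\<Sum>j<n. (a j)\<^sup>2)\<^sup>2) \<le>
      exp (1 / (4 * l)) * ?g a" for a :: "nat \<Rightarrow> real"
  proof -
    have "- (\<Sum>j<n. \<beta> j * (a j)\<^sup>2) - l * (\<Sum>j<n. (a j)\<^sup>2)\<^sup>2 \<le>
        1 / (4 * l) + - (\<Sum>j<n. (\<beta> j + 1) * (a j)\<^sup>2)"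
      using neg_mult_square_le[OF l, of "\<Sum>j<n. (a j)\<^sup>2"]
      by (simp add: algebra_simps sum.distrib)
    then have "exp (- (\<Sum>j<n. \<beta> j * (a j)\<^sup>2) - l * (\<Sum>j<n. (a j)\<^sup>2)\<^sup>2) \<le>
        exp (1 / (4 * l)) * exp (- (\<Sum>j<n. (\<beta> j + 1) * (a j)\<^sup>2))"
      by (simp flip: exp_add)
    from mult_left_mono[OF this c] show ?thesis
      by (simp add: ac_simps)
  qed
  have "Z_fin n l \<beta> \<le> (\<integral>a. exp (1 / (4 * l)) * ?g a \<partial>(\<Pi>\<^sub>M j\<in>{..<n}. lborel))"
    unfolding Z_fin_def
  \<comment> \<open>This rule asks for an integrable majorant that is nonnegative; the sign
    condition covers the default value 0 of the Bochner integral on the left.\<close>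
  proof (rule integral_mono')
    show "integrable (\<Pi>\<^sub>M j\<in>{..<n}. lborel) (\<lambda>a. exp (1 / (4 * l)) * ?g a)"
      by (intro integrable_mult_right integrable_prod_gaussian finite_lessThan pos1)
    show "0 \<le> exp (1 / (4 * l)) * ?g a" for a
      using c by (intro mult_nonneg_nonneg exp_ge_zero)
  qed (rule le)
  also have "\<dots> = exp (1 / (4 * l)) * (\<Prod>j<n. 1 / sqrt (pi / \<beta> j) * sqrt (pi / (\<beta> j + 1)))"
    by (subst integral_mult_right_zero)
      (simp only: integral_prod_gaussian[OF finite_lessThan pos1])
  also have "(\<Prod>j<n. 1 / sqrt (pi / \<beta> j) * sqrt (pi / (\<beta> j + 1))) =
      (\<Prod>j<n. 1 / sqrt (1 + 1 / \<beta> j))"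
  proof (rule prod.cong[OF refl])
    fix j
    have "1 + 1 / \<beta> j = (\<beta> j + 1) / \<beta> j"
      using pos[of j] by (simp add: field_simps)
    then show "1 / sqrt (pi / \<beta> j) * sqrt (pi / (\<beta> j + 1)) = 1 / sqrt (1 + 1 / \<beta> j)"
      using pos[of j] pos1[of j] by (simp add: real_sqrt_divide)
  qed
  also have "\<dots> = 1 / sqrt (\<Prod>j<n. 1 + 1 / \<beta> j)"
    by (simp add: prod_dividef sqrt_prod)
  finally show ?thesis by simp
qed

text \<open>Expanding the product produces every \<open>f j\<close> among nonnegative terms, so the
  product dominates the partial sums, which are unbounded.\<close>

lemma filterlim_prod_one_plus_at_top:
  fixes f :: "nat \<Rightarrow> real"
  assumes nonneg: "\<And>j. 0 \<le> f j" and "\<not> summable f"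
  shows "filterlim (\<lambda>n. \<Prod>j<n. 1 + f j) at_top sequentially"
proof (rule filterlim_at_top_mono)
  have "incseq (\<lambda>n. \<Sum>j<n. f j)"
    using nonneg by (intro incseq_SucI) simp
  \<comment> \<open>Otherwise \<open>K\<close> would bound all partial sums, and a nonnegative
    series with bounded partial sums is summable.\<close>
  moreover have "\<exists>n. K \<le> (\<Sum>j<n. f j)" for K
    using assms(2) summableI_nonneg_bounded[of f K, OF nonneg] linear by blast
  ultimately show "filterlim (\<lambda>n. \<Sum>j<n. f j) at_top sequentially"
    unfolding filterlim_at_top eventually_sequentially by (meson incseqD order_trans)
  have "(\<Sum>j<n. f j) \<le> (\<Prod>j<n. 1 + f j)" for n
    using sum_le_prod[of "{..<n}" f] nonneg by auto
  then show "\<forall>\<^sub>F n in sequentially. (\<Sum>j<n. f j) \<le> (\<Prod>j<n. 1 + f j)"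
    by simp
qed

theorem lemma4:
  fixes \<beta> :: "nat \<Rightarrow> real"
  assumes "\<beta> \<in> seq_class 2 - seq_class 1"
  shows "(\<forall>l>0. convergent (\<lambda>n. Z_fin n l \<beta>) \<and> Z_lim l \<beta> = 0) \<and>
    convergent (\<lambda>n. Z_fin n 0 \<beta>) \<and> Z_lim 0 \<beta> = 1"
proof -
  have pos: "\<beta> j > 0" for j
    using assms by (simp add: seq_class_def)
  \<comment> \<open>Positivity is already granted by \<open>seq_class 2\<close>, so lying outside
    \<open>seq_class 1\<close> can only mean divergence.\<close>
  have div: "\<not> summable (\<lambda>j. 1 / \<beta> j)"
    using assms by (auto simp: seq_class_def)
  have lim: "(\<lambda>n. Z_fin n l \<beta>) \<longlonglongrightarrow> 0" if l: "l > 0" for l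
  \<comment> \<open>The squeeze is between 0 and the bound of \<open>Z_fin_le\<close>, whose
    numerator is fixed once \<open>l\<close> is.\<close>
  proof (rule tendsto_sandwich[OF _ _ tendsto_const])
    show "\<forall>\<^sub>F n in sequentially. 0 \<le> Z_fin n l \<beta>"
      by (simp add: Z_fin_nonneg pos)
    show "\<forall>\<^sub>F n in sequentially. Z_fin n l \<beta> \<le> exp (1 / (4 * l)) / sqrt (\<Prod>j<n. 1 + 1 / \<beta> j)"
      by (simp add: Z_fin_le pos l)
    have "filterlim (\<lambda>n. \<Prod>j<n. 1 + 1 / \<beta> j) at_top sequentially"
      using pos div by (intro filterlim_prod_one_plus_at_top) (auto intro: less_imp_le)
    then have "filterlim (\<lambda>n. sqrt (\<Prod>j<n. 1 + 1 / \<beta> j)) at_top sequentially"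
      by (rule filterlim_compose[OF sqrt_at_top])
    then show "(\<lambda>n. exp (1 / (4 * l)) / sqrt (\<Prod>j<n. 1 + 1 / \<beta> j)) \<longlonglongrightarrow> 0"
      by (intro tendsto_divide_0[OF tendsto_const] filterlim_at_top_imp_at_infinity)
  qed
  have lim0: "(\<lambda>n. Z_fin n 0 \<beta>) \<longlonglongrightarrow> 1"
    by (simp add: Z_fin_zero pos)
  \<comment> \<open>Each limit yields both claims: a witness for \<open>convergent\<close> and, by
    uniqueness of limits, the value of \<open>lim\<close>.\<close>
  show ?thesis
    using lim lim0 by (auto simp: Z_lim_def convergent_def intro: limI)
qed

end
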